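(* Let $\rho:\mathbb{R}\to(0,\infty)$ be $2\pi$-periodic, let $\bar\Omega$ be the associated starlike domain in polar coordinates, and let $S(\xi,\phi)=\left(\frac{2\xi}{\rho(\phi)},\phi\right)$, with inverse $S^{-1}(r,\theta)=\left(\frac{r\rho(\theta)}{2},\theta\right)$. Let $\mathcal{I}$ be the tensor product interpolant on $E$ at the nodes $(y_i,\psi_j)$, either Chebyshev times equispaced nodes or conformally shifted ones, and let $\mathcal{I}^S$ be the corresponding interpolant on $\bar\Omega$. Then for every function $f:\bar\Omega\to\mathbb{R}$, $$\|f-\mathcal{I}^S[f]\|_{\bar\Omega}=\|h-\mathcal{I}[h]\|_{E},\qquad\text{where } h=f\circ S^{-1}.$$
   Context: The starlike domain (with center at the origin) is written in polar coordinates as $\bar\Omega=\{(\xi,\phi):0\le\xi\le\rho(\phi),\ \phi\in[0,2\pi)\}$, and $E=[0,2]\times[0,2\pi)$ (polar coordinates of the closed disk of radius 2), so $S(\bar\Omega)=E$. $\|\cdot\|_X$ denotes the supremum norm over $X$ (with values in $[0,\infty]$). Let $r_i=1-\cos(i\pi/n_1)$, $i=0,\dots,n_1$, and $\theta_j=2\pi j/n_2$, $j=0,\dots,n_2-1$; $\delta_0=\delta_{n_1}=1/2$ and $\delta_i=1$ otherwise; $\operatorname{cst}=\csc$ if $n_2$ is odd, $\operatorname{cst}=\cot$ if $n_2$ is even. The nodes are either $y_i=r_i$, $\psi_j=\theta_j$, or $y_i=g_1(r_i)$, $\psi_j=g_2(\theta_j)$, where $g_1:[0,2]\to[0,2]$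 and $g_2:[0,2\pi)\to[0,2\pi)$ are bijections that are restrictions of conformal maps ($g_2$ satisfying $g_2(\theta+2\pi)=g_2(\theta)+2\pi$). Define $$b_i^{(1)}(y)=\frac{\frac{(-1)^i\delta_i}{y-y_i}}{\sum_{k=0}^{n_1}\frac{(-1)^k\delta_k}{y-y_k}},\qquad b_j^{(2)}(\psi)=\frac{(-1)^j\operatorname{cst}\left(\frac{\psi-\psi_j}{2}\right)}{\sum_{k=0}^{n_2-1}(-1)^k\operatorname{cst}\left(\frac{\psi-\psi_k}{2}\right)},$$ extended by continuity at the nodes. For $h:E\to\mathbb{R}$, $$\mathcal{I}[h](y,\psi)=\sum_{i=0}^{n_1}\sum_{j=0}^{n_2-1}h(y_i,\psi_j)\,b_i^{(1)}(y)\,b_j^{(2)}(\psi),$$ and for $f:\bar\Omega\to\mathbb{R}$, $$\mathcal{I}^S[f](\xi,\phi)=\sum_{i=0}^{n_1}\sum_{j=0}^{n_2-1}f\left(\tfrac{y_i\rho(\psi_j)}{2},\psi_j\right)b_i^{(1)}\left(\tfrac{2\xi}{\rho(\phi)}\right)b_j^{(2)}(\phi).$$ *)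

theory Defs
  imports "HOL-Analysis.Analysis"
begin

(* Points of the starlike domain and of the disk are pairs of polar coordinates
   (radius, angle). A function on a set X of such pairs is a total function on
   real \<times> real; only its values on X are ever used. *)

definition starlike_domain :: "(real \<Rightarrow> real) \<Rightarrow> (real \<times> real) set" where
  "starlike_domain \<rho> = {(\<xi>, \<phi>). 0 \<le> \<xi> \<and> \<xi> \<le> \<rho> \<phi> \<and> \<phi> \<in> {0..<2 * pi}}"

definition disk2 :: "(real \<times> real) set" where
  "disk2 = {0..2} \<times> {0..<2 * pi}"

definition star_map :: "(real \<Rightarrow> real) \<Rightarrow> real \<times> real \<Rightarrow> real \<times> real" where
  "star_map \<rho> = (\<lambda>(\<xi>, \<phi>). (2 * \<xi> / \<rho> \<phi>, \<phi>))"

definition star_map_inv :: "(real \<Rightarrow> real) \<Rightarrow> real \<times> real \<Rightarrow> real \<times> real" where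
  "star_map_inv \<rho> = (\<lambda>(r, \<theta>). (r * \<rho> \<theta> / 2, \<theta>))"

definition sup_norm_on :: "'a set \<Rightarrow> ('a \<Rightarrow> real) \<Rightarrow> ennreal" where
  "sup_norm_on X g = (SUP x\<in>X. ennreal \<bar>g x\<bar>)"

definition cheb_node :: "nat \<Rightarrow> nat \<Rightarrow> real" where
  "cheb_node n1 i = 1 - cos (real i * pi / real n1)"

definition equi_node :: "nat \<Rightarrow> nat \<Rightarrow> real" where
  "equi_node n2 j = 2 * pi * real j / real n2"

(* A conformal map of a domain D is taken as a biholomorphic map of D onto its image. *)
definition conformal_on :: "(complex \<Rightarrow> complex) \<Rightarrow> complex set \<Rightarrow> bool" where
  "conformal_on G D \<longleftrightarrow> open D \<and> connected D \<and> G holomorphic_on D \<and> inj_on G D"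

definition restricts_conformal :: "(real \<Rightarrow> real) \<Rightarrow> real set \<Rightarrow> bool" where
  "restricts_conformal g X \<longleftrightarrow>
     (\<exists>G D. conformal_on G D \<and> complex_of_real ` X \<subseteq> D \<and>
            (\<forall>x\<in>X. G (complex_of_real x) = complex_of_real (g x)))"

definition radial_shift :: "(real \<Rightarrow> real) \<Rightarrow> bool" where
  "radial_shift g1 \<longleftrightarrow> bij_betw g1 {0..2} {0..2} \<and> restricts_conformal g1 {0..2}"

definition angular_shift :: "(real \<Rightarrow> real) \<Rightarrow> bool" where
  "angular_shift g2 \<longleftrightarrow>
     bij_betw g2 {0..<2 * pi} {0..<2 * pi} \<and> restricts_conformal g2 {0..<2 * pi} \<and>
     (\<forall>\<theta>. g2 (\<theta> + 2 * pi) = g2 \<theta> + 2 * pi)"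

definition tensor_nodes :: "nat \<Rightarrow> nat \<Rightarrow> (nat \<Rightarrow> real) \<Rightarrow> (nat \<Rightarrow> real) \<Rightarrow> bool" where
  "tensor_nodes n1 n2 y \<psi> \<longleftrightarrow>
     (\<forall>i\<le>n1. y i = cheb_node n1 i) \<and> (\<forall>j<n2. \<psi> j = equi_node n2 j) \<or>
     (\<exists>g1 g2. radial_shift g1 \<and> angular_shift g2 \<and>
        (\<forall>i\<le>n1. y i = g1 (cheb_node n1 i)) \<and> (\<forall>j<n2. \<psi> j = g2 (equi_node n2 j)))"

definition bary_weight :: "nat \<Rightarrow> nat \<Rightarrow> real" where
  "bary_weight n1 i = (if i = 0 \<or> i = n1 then 1 / 2 else 1)"

definition cst :: "nat \<Rightarrow> real \<Rightarrow> real" where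
  "cst n2 x = (if odd n2 then 1 / sin x else cot x)"

definition radial_quotient :: "nat \<Rightarrow> (nat \<Rightarrow> real) \<Rightarrow> nat \<Rightarrow> real \<Rightarrow> real" where
  "radial_quotient n1 y i x =
     ((-1) ^ i * bary_weight n1 i / (x - y i)) /
     (\<Sum>k\<le>n1. (-1) ^ k * bary_weight n1 k / (x - y k))"

definition angular_quotient :: "nat \<Rightarrow> (nat \<Rightarrow> real) \<Rightarrow> nat \<Rightarrow> real \<Rightarrow> real" where
  "angular_quotient n2 \<psi> j x =
     ((-1) ^ j * cst n2 ((x - \<psi> j) / 2)) /
     (\<Sum>k<n2. (-1) ^ k * cst n2 ((x - \<psi> k) / 2))"

definition radial_basis :: "nat \<Rightarrow> (nat \<Rightarrow> real) \<Rightarrow> nat \<Rightarrow> real \<Rightarrow> real" where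
  "radial_basis n1 y i x =
     (if x \<in> y ` {..n1} then Lim (at x) (radial_quotient n1 y i)
      else radial_quotient n1 y i x)"

definition angular_basis :: "nat \<Rightarrow> (nat \<Rightarrow> real) \<Rightarrow> nat \<Rightarrow> real \<Rightarrow> real" where
  "angular_basis n2 \<psi> j x =
     (if x \<in> \<psi> ` {..<n2} then Lim (at x) (angular_quotient n2 \<psi> j)
      else angular_quotient n2 \<psi> j x)"

definition disk_interpolant ::
  "nat \<Rightarrow> nat \<Rightarrow> (nat \<Rightarrow> real) \<Rightarrow> (nat \<Rightarrow> real) \<Rightarrow> (real \<times> real \<Rightarrow> real) \<Rightarrow> real \<times> real \<Rightarrow> real" where
  "disk_interpolant n1 n2 y \<psi> h = (\<lambda>(r, \<theta>).
     \<Sum>i\<le>n1. \<Sum>j<n2. h (y i, \<psi> j) * radial_basis n1 y i r * angular_basis n2 \<psi> j \<theta>)"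

definition starlike_interpolant ::
  "(real \<Rightarrow> real) \<Rightarrow> nat \<Rightarrow> nat \<Rightarrow> (nat \<Rightarrow> real) \<Rightarrow> (nat \<Rightarrow> real) \<Rightarrow> (real \<times> real \<Rightarrow> real)
    \<Rightarrow> real \<times> real \<Rightarrow> real" where
  "starlike_interpolant \<rho> n1 n2 y \<psi> f = (\<lambda>(\<xi>, \<phi>).
     \<Sum>i\<le>n1. \<Sum>j<n2. f (y i * \<rho> (\<psi> j) / 2, \<psi> j) *
        radial_basis n1 y i (2 * \<xi> / \<rho> \<phi>) * angular_basis n2 \<psi> j \<phi>)"

lemma star_map_bij:
  assumes "\<And>\<phi>. \<rho> \<phi> > 0"
  shows "bij_betw (star_map \<rho>) (starlike_domain \<rho>) disk2"
    and "\<And>p. star_map_inv \<rho> (star_map \<rho> p) = p"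
    and "\<And>q. star_map \<rho> (star_map_inv \<rho> q) = q"
proof -
  have nz: "\<rho> \<phi> \<noteq> 0" for \<phi>
    using assms[of \<phi>] by simp
  show li: "star_map_inv \<rho> (star_map \<rho> p) = p" for p
    using nz by (cases p) (simp add: star_map_def star_map_inv_def)
  show ri: "star_map \<rho> (star_map_inv \<rho> q) = q" for q
    using nz by (cases q) (simp add: star_map_def star_map_inv_def)
  show "bij_betw (star_map \<rho>) (starlike_domain \<rho>) disk2"
  proof (rule bij_betw_byWitness[where f' = "star_map_inv \<rho>"])
    show "star_map \<rho> ` starlike_domain \<rho> \<subseteq> disk2"
      using assms
      by (auto simp: star_map_def starlike_domain_def disk2_def divide_le_eq
               intro!: divide_nonneg_pos)
    show "star_map_inv \<rho> ` disk2 \<subseteq> starlike_domain \<rho>"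
    proof (clarsimp simp: star_map_inv_def starlike_domain_def disk2_def)
      fix r \<theta> :: real
      assume "0 \<le> r" "r \<le> 2"
      then show "0 \<le> r * \<rho> \<theta> \<and> r * \<rho> \<theta> \<le> \<rho> \<theta> * 2"
        using assms[of \<theta>] by (simp add: mult.commute)
    qed
  qed (use li ri in auto)
qed

(* The limits in the basis functions exist and give the Lagrange property at the nodes. *)

lemma quotient_tendsto:
  fixes u :: "nat \<Rightarrow> real \<Rightarrow> real" and d :: "real \<Rightarrow> real"
  assumes A: "finite A" "m \<in> A" "i \<in> A"
    and d0: "eventually (\<lambda>x. d x \<noteq> 0) F"
    and m: "((\<lambda>x. d x * u m x) \<longlongrightarrow> c) F" "c \<noteq> 0"
    and k: "\<And>k. k \<in> A \<Longrightarrow> k \<noteq> m \<Longrightarrow> ((\<lambda>x. d x * u k x) \<longlongrightarrow> 0) F"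
  shows "((\<lambda>x. u i x / (\<Sum>k\<in>A. u k x)) \<longlongrightarrow> (if i = m then 1 else 0)) F"
proof -
  have each: "((\<lambda>x. d x * u k x) \<longlongrightarrow> (if k = m then c else 0)) F" if "k \<in> A" for k
    using m(1) k that by auto
  have "((\<lambda>x. \<Sum>k\<in>A. d x * u k x) \<longlongrightarrow> (\<Sum>k\<in>A. if k = m then c else 0)) F"
    by (rule tendsto_sum) (use each in auto)
  then have den: "((\<lambda>x. \<Sum>k\<in>A. d x * u k x) \<longlongrightarrow> c) F"
    using A by simp
  have "((\<lambda>x. d x * u i x / (\<Sum>k\<in>A. d x * u k x)) \<longlongrightarrow> (if i = m then c else 0) / c) F"
    by (rule tendsto_divide[OF each[OF A(3)] den m(2)])
  moreover have "eventually (\<lambda>x. d x * u i x / (\<Sum>k\<in>A. d x * u k x)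
      = u i x / (\<Sum>k\<in>A. u k x)) F"
    using d0 by eventually_elim (simp add: sum_distrib_left[symmetric])
  ultimately show ?thesis
    using m(2) by (auto simp: tendsto_cong split: if_splits)
qed

lemma radial_basis_node:
  assumes "inj_on y {..n1}" "i \<le> n1" "m \<le> n1"
  shows "radial_basis n1 y i (y m) = (if i = m then 1 else 0)"
proof -
  define u where "u k x = (-1) ^ k * bary_weight n1 k / (x - y k)" for k x
  have "((\<lambda>x. u i x / (\<Sum>k\<le>n1. u k x)) \<longlongrightarrow> (if i = m then 1 else 0)) (at (y m))"
  proof (rule quotient_tendsto[where d = "\<lambda>x. x - y m" and c = "(-1) ^ m * bary_weight n1 m"])
    show ev: "eventually (\<lambda>x. x - y m \<noteq> 0) (at (y m))"
      by (simp add: eventually_at_filter)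
    have "eventually (\<lambda>x. (x - y m) * u m x = (-1) ^ m * bary_weight n1 m) (at (y m))"
      using ev by eventually_elim (simp add: u_def)
    then show "((\<lambda>x. (x - y m) * u m x) \<longlongrightarrow> (-1) ^ m * bary_weight n1 m) (at (y m))"
      by (rule tendsto_eventually)
    show "((\<lambda>x. (x - y m) * u k x) \<longlongrightarrow> 0) (at (y m))" if "k \<in> {..n1}" "k \<noteq> m" for k
    proof -
      have "y m - y k \<noteq> 0"
        using assms that by (auto simp: inj_on_def)
      then show ?thesis
        unfolding u_def by (auto intro!: tendsto_eq_intros)
    qed
  qed (use assms in \<open>auto simp: bary_weight_def\<close>)
  then have "Lim (at (y m)) (radial_quotient n1 y i) = (if i = m then 1 else 0)"
    by (intro tendsto_Lim) (auto simp: radial_quotient_def[abs_def] u_def)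
  then show ?thesis
    using assms by (simp add: radial_basis_def)
qed

lemma angular_basis_node:
  assumes "inj_on \<psi> {..<n2}" "\<psi> ` {..<n2} \<subseteq> {0..<2 * pi}" "j < n2" "m < n2"
  shows "angular_basis n2 \<psi> j (\<psi> m) = (if j = m then 1 else 0)"
proof -
  define u where "u k x = (-1) ^ k * cst n2 ((x - \<psi> k) / 2)" for k x
  have sin_nz: "sin t \<noteq> 0" if "\<bar>t\<bar> < pi" "t \<noteq> 0" for t :: real
    using sin_gt_zero[of t] sin_gt_zero[of "-t"] that by (cases "t > 0") auto
  have "((\<lambda>x. u j x / (\<Sum>k<n2. u k x)) \<longlongrightarrow> (if j = m then 1 else 0)) (at (\<psi> m))"
  proof (rule quotient_tendsto[where d = "\<lambda>x. sin ((x - \<psi> m) / 2)" and c = "(-1) ^ m"])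
    have "eventually (\<lambda>x. x \<in> {\<psi> m - 1 <..< \<psi> m + 1} - {\<psi> m}) (at (\<psi> m))"
      by (rule eventually_at_in_open) auto
    then show ev: "eventually (\<lambda>x. sin ((x - \<psi> m) / 2) \<noteq> 0) (at (\<psi> m))"
    proof eventually_elim
      case (elim x)
      then show ?case
        using pi_gt3 by (intro sin_nz) auto
    qed
    have "eventually (\<lambda>x. (-1) ^ m * (if odd n2 then 1 else cos ((x - \<psi> m) / 2))
        = sin ((x - \<psi> m) / 2) * u m x) (at (\<psi> m))"
      using ev by eventually_elim (auto simp: u_def cst_def cot_def)
    moreover have "((\<lambda>x. (-1) ^ m * (if odd n2 then 1 else cos ((x - \<psi> m) / 2)))
        \<longlongrightarrow> (-1) ^ m) (at (\<psi> m))"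
      by (cases "odd n2") (auto intro!: tendsto_eq_intros)
    ultimately show "((\<lambda>x. sin ((x - \<psi> m) / 2) * u m x) \<longlongrightarrow> (-1) ^ m) (at (\<psi> m))"
      by (rule Lim_transform_eventually[rotated])
    show "((\<lambda>x. sin ((x - \<psi> m) / 2) * u k x) \<longlongrightarrow> 0) (at (\<psi> m))"
      if "k \<in> {..<n2}" "k \<noteq> m" for k
    proof -
      have "\<psi> m \<noteq> \<psi> k" "\<psi> m \<in> {0..<2 * pi}" "\<psi> k \<in> {0..<2 * pi}"
        using assms that by (auto simp: inj_on_def)
      then have "sin ((\<psi> m - \<psi> k) / 2) \<noteq> 0"
        by (intro sin_nz) (auto simp: abs_if field_simps)
      then show ?thesis
        unfolding u_def cst_def cot_def by (cases "odd n2") (auto intro!: tendsto_eq_intros)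
    qed
  qed (use assms in auto)
  then have "Lim (at (\<psi> m)) (angular_quotient n2 \<psi> j) = (if j = m then 1 else 0)"
    by (intro tendsto_Lim) (auto simp: angular_quotient_def[abs_def] u_def)
  then show ?thesis
    using assms by (simp add: angular_basis_def)
qed

lemma tensor_nodes_distinct:
  assumes "n1 \<ge> 1" "tensor_nodes n1 n2 y \<psi>"
  shows "inj_on y {..n1}" "inj_on \<psi> {..<n2}"
    and "y ` {..n1} \<subseteq> {0..2}" "\<psi> ` {..<n2} \<subseteq> {0..<2 * pi}"
proof -
  let ?c = "cheb_node n1" and ?e = "equi_node n2"
  have ic: "inj_on ?c {..n1}"
  proof (rule inj_onI)
    fix i j
    assume ij: "i \<in> {..n1}" "j \<in> {..n1}" "?c i = ?c j"
    then have "cos (real i * pi / real n1) = cos (real j * pi / real n1)"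
      by (simp add: cheb_node_def)
    moreover have "real k * pi / real n1 \<in> {0..pi}" if "k \<le> n1" for k
    proof -
      have "real k * pi \<le> real n1 * pi"
        using that by (intro mult_right_mono) auto
      then show ?thesis
        using assms(1) by (simp add: pos_divide_le_eq mult.commute[of pi])
    qed
    ultimately have "real i * pi / real n1 = real j * pi / real n1"
      using ij(1,2) cos_inj_pi[of "real i * pi / real n1" "real j * pi / real n1"]
      unfolding atLeastAtMost_iff atMost_iff by blast
    then show "i = j"
      using assms(1) by simp
  qed
  have rc: "?c ` {..n1} \<subseteq> {0..2}"
  proof (rule image_subsetI)
    fix i
    show "?c i \<in> {0..2}"
      using cos_le_one[of "real i * pi / real n1"] cos_ge_minus_one[of "real i * pi / real n1"]
      unfolding cheb_node_def atLeastAtMost_iff by linarith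
  qed
  have ie: "inj_on ?e {..<n2}"
    by (auto simp: inj_on_def equi_node_def)
  have re: "?e ` {..<n2} \<subseteq> {0..<2 * pi}"
    by (auto simp: equi_node_def divide_less_eq)
  from assms(2) consider
      (plain) "\<forall>i\<le>n1. y i = ?c i" "\<forall>j<n2. \<psi> j = ?e j"
    | (shifted) g1 g2 where "bij_betw g1 {0..2} {0..2}" "bij_betw g2 {0..<2 * pi} {0..<2 * pi}"
        "\<forall>i\<le>n1. y i = g1 (?c i)" "\<forall>j<n2. \<psi> j = g2 (?e j)"
    unfolding tensor_nodes_def radial_shift_def angular_shift_def by blast
  then have "(inj_on y {..n1} \<and> inj_on \<psi> {..<n2}) \<and>
      y ` {..n1} \<subseteq> {0..2} \<and> \<psi> ` {..<n2} \<subseteq> {0..<2 * pi}"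
  proof cases
    case plain
    have "inj_on y {..n1} = inj_on ?c {..n1}" "inj_on \<psi> {..<n2} = inj_on ?e {..<n2}"
      by (rule inj_on_cong, use plain in simp)+
    moreover have "y ` {..n1} = ?c ` {..n1}" "\<psi> ` {..<n2} = ?e ` {..<n2}"
      by (rule image_cong[OF refl], use plain in simp)+
    ultimately show ?thesis
      using ic ie rc re by simp
  next
    case (shifted g1 g2)
    have "inj_on (g1 \<circ> ?c) {..n1}" "inj_on (g2 \<circ> ?e) {..<n2}"
      using shifted(1,2) ic ie rc re by (meson bij_betw_def comp_inj_on inj_on_subset)+
    moreover have "inj_on y {..n1} = inj_on (g1 \<circ> ?c) {..n1}"
      "inj_on \<psi> {..<n2} = inj_on (g2 \<circ> ?e) {..<n2}"
      by (rule inj_on_cong, use shifted(3,4) in simp)+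
    moreover have "y ` {..n1} \<subseteq> g1 ` {0..2}"
      using shifted(3) rc by auto
    moreover have "\<psi> ` {..<n2} \<subseteq> g2 ` {0..<2 * pi}"
      using shifted(4) re by auto
    ultimately show ?thesis
      using shifted(1,2) by (auto simp: bij_betw_def)
  qed
  then show "inj_on y {..n1}" "inj_on \<psi> {..<n2}"
    and "y ` {..n1} \<subseteq> {0..2}" "\<psi> ` {..<n2} \<subseteq> {0..<2 * pi}"
    by blast+
qed

end

theory Submission
  imports Defs
begin

text \<open>Interpolation commutes with the change of variables S = \<open>star_map \<rho>\<close>:
  the starlike interpolant of f is the disk interpolant of h composed with S. Since also f = h o S,
  the error on the domain is the disk error composed with S, and S maps the domain onto the disk, so
  the suprema agree.\<close>

lemma sup_norm_on_image: "sup_norm_on (s ` X) g = sup_norm_on X (g \<circ> s)"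
  by (simp add: sup_norm_on_def image_image)

text \<open>The sums agree term by term: S leaves the angle fixed, and its inverse sends each disk
  node to the point where f is sampled.\<close>

lemma starlike_interpolant_eq_disk_interpolant:
  "starlike_interpolant \<rho> n1 n2 y \<psi> f =
    disk_interpolant n1 n2 y \<psi> (f \<circ> star_map_inv \<rho>) \<circ> star_map \<rho>"
  by (auto simp: fun_eq_iff starlike_interpolant_def disk_interpolant_def
      star_map_def star_map_inv_def)

theorem theorem11:
  fixes \<rho> :: "real \<Rightarrow> real"
    and n1 n2 :: nat
    and y \<psi> :: "nat \<Rightarrow> real"
    and f h :: "real \<times> real \<Rightarrow> real"
  assumes "\<And>\<phi>. \<rho> \<phi> > 0"
    and "\<And>\<phi>. \<rho> (\<phi> + 2 * pi) = \<rho> \<phi>"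
    and "n1 \<ge> 1" and "n2 \<ge> 1"
    and "tensor_nodes n1 n2 y \<psi>"
    and "h = f \<circ> star_map_inv \<rho>"
  shows "sup_norm_on (starlike_domain \<rho>) (\<lambda>p. f p - starlike_interpolant \<rho> n1 n2 y \<psi> f p)
       = sup_norm_on disk2 (\<lambda>q. h q - disk_interpolant n1 n2 y \<psi> h q)"
proof -
  note S = star_map_bij[of \<rho>, OF assms(1)]
  have img: "disk2 = star_map \<rho> ` starlike_domain \<rho>"
    using S(1) by (simp add: bij_betw_def)
  show ?thesis
    \<comment> \<open>Both suprema now range over the starlike domain; the integrands agree
      pointwise because \<open>S(2)\<close> gives h o S = f.\<close>
    unfolding img sup_norm_on_image
    by (simp add: assms(6) starlike_interpolant_eq_disk_interpolant S(2) o_def)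
qed

end
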